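(* Let $a=\frac{5-\sqrt5}{10}$ and $b=\frac{79\sqrt5-165}{70}$. For every tree $T$ of order $n$ that is not a path, $\mathrm{avi}(T)\ge an+b$. Consequently, the path minimises $\mathrm{avi}$ among all trees of order $n$: for every positive integer $n$ and every tree $T$ with $n$ vertices, $\mathrm{avi}(P_n)\le \mathrm{avi}(T)$, where $P_n$ is the path with $n$ vertices.
   Context: All graphs are finite and simple; the order of a graph is its number of vertices. For a graph $G$, an independent set is a set of pairwise non-adjacent vertices (the empty set is independent). $\mathrm{avi}(G)$ denotes the average size of independent sets of $G$: $\mathrm{avi}(G)=\mathrm{T}(G)/\mathrm{I}(G)$, where $\mathrm{I}(G)$ is the number of independent sets of $G$ and $\mathrm{T}(G)$ is the sum of the cardinalities of all independent sets of $G$. *)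

theory Defs
  imports Complex_Main "Graph_Theory.Graph_Theory"
begin

text \<open>
  A finite simple graph is a \<open>pair_graph\<close>: every undirected edge is represented by its two
  opposite arcs.
\<close>

text \<open>
  The library predicate \<open>tree\<close> is meant for digraphs: it counts an edge traversed back and forth
  as a cycle of length 2, so a \<open>pair_graph\<close> with an edge never satisfies it.
  An undirected cycle is a cycle of length at least 3.
  The library's \<open>connected\<close> requires a vertex, so the empty graph is not a tree.
  It is qualified because topological connectedness has the same base name.
\<close>

definition undirected_cycle :: "'a pair_pre_digraph \<Rightarrow> ('a \<times> 'a) awalk \<Rightarrow> bool" where
  "undirected_cycle G p \<longleftrightarrow> pre_digraph.cycle (with_proj G) p \<and> 3 \<le> length p"

definition undirected_tree :: "'a pair_pre_digraph \<Rightarrow> bool" where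
  "undirected_tree G \<longleftrightarrow>
     pair_graph G \<and> Digraph_Component.connected (with_proj G) \<and> \<not> (\<exists>p. undirected_cycle G p)"

definition independent_set :: "'a pair_pre_digraph \<Rightarrow> 'a set \<Rightarrow> bool" where
  "independent_set G S \<longleftrightarrow> S \<subseteq> pverts G \<and> pairwise (\<lambda>u v. (u, v) \<notin> parcs G) S"

definition num_indep :: "'a pair_pre_digraph \<Rightarrow> nat" where
  "num_indep G = card {S. independent_set G S}"

definition total_indep :: "'a pair_pre_digraph \<Rightarrow> nat" where
  "total_indep G = (\<Sum>S | independent_set G S. card S)"

definition avi :: "'a pair_pre_digraph \<Rightarrow> real" where
  "avi G = real (total_indep G) / real (num_indep G)"

definition path_graph :: "nat \<Rightarrow> nat pair_pre_digraph" where
  "path_graph n =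
     \<lparr> pverts = {..<n}, parcs = {(i, j). i < n \<and> j < n \<and> (j = Suc i \<or> i = Suc j)} \<rparr>"

definition is_path :: "'a pair_pre_digraph \<Rightarrow> bool" where
  "is_path G \<longleftrightarrow> (\<exists>n. digraph_iso (with_proj G) (with_proj (path_graph n)))"

end

theory Submission
  imports Defs
begin

text \<open>
  Write \<open>exc S\<close> for the excess of the average size of an independent set of the subgraph induced by
  \<open>S\<close> over \<open>slope * card S\<close>; it is additive over components. Conditioning on whether a vertex \<open>v\<close>
  belongs to the independent set gives
  \<open>(1 + t) * (exc S - c) = A + t * B\<close>, where \<open>A\<close> and \<open>B\<close> are sums over the components \<open>C\<close> of \<open>S - {v}\<close>
  (respectively, over these components without their neighbours of \<open>v\<close>) and \<open>t\<close> is the product of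
  the ratios of the corresponding numbers of independent sets.
  A tree with a vertex of degree at least 3 has such a vertex \<open>v\<close> for which all components of
  \<open>S - {v}\<close> but one are paths attached at an end: choose \<open>v\<close> and the exceptional component so that
  the latter is as large as possible. By induction the exceptional component is either a path or has
  excess at least \<open>offset\<close>, and \<open>A + t * B \<ge> 0\<close> for \<open>c = offset\<close> follows from explicit estimates for
  paths.
\<close>

section \<open>Paths and the numerical estimates\<close>

definition slope :: real where "slope = (5 - sqrt 5) / 10"
definition offset :: real where "offset = (79 * sqrt 5 - 165) / 70"

lemma sqrt5_bounds: "2.23606 < sqrt 5" "sqrt 5 < 2.23607"
  by (rule real_less_rsqrt, simp add: power2_eq_square)
     (rule real_less_lsqrt, simp_all add: power2_eq_square)

lemma slope_bounds: "0.27639 < slope" "slope < 0.2764"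
  using sqrt5_bounds by (simp_all add: slope_def)

lemma offset_bounds: "0.1664 < offset" "offset < 0.16643"
  using sqrt5_bounds by (simp_all add: offset_def)

text \<open>Number and total size of the independent sets of a path with \<open>n\<close> vertices,
  by conditioning on an end vertex; \<open>leg_counts\<close> makes the connection.
  \<open>path_cnt n\<close> is the Fibonacci number of index \<open>n + 2\<close>.\<close>

fun path_cnt :: "nat \<Rightarrow> nat" where
  "path_cnt 0 = 1"
| "path_cnt (Suc 0) = 2"
| "path_cnt (Suc (Suc n)) = path_cnt (Suc n) + path_cnt n"

fun path_tot :: "nat \<Rightarrow> nat" where
  "path_tot 0 = 0"
| "path_tot (Suc 0) = 1"
| "path_tot (Suc (Suc n)) = path_tot (Suc n) + path_tot n + path_cnt n"

definition path_exc :: "nat \<Rightarrow> real" where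
  "path_exc n = real (path_tot n) / real (path_cnt n) - slope * real n"

lemma path_cnt_pos [simp]: "0 < path_cnt n"
  by (induction n rule: path_cnt.induct) auto

lemma path_exc_simps [simp]:
  "path_exc 0 = 0" "path_exc (Suc 0) = 1 / 2 - slope" "path_exc 2 = 2 / 3 - 2 * slope"
  "path_exc 3 = 1 - 3 * slope" "path_exc 4 = 5 / 4 - 4 * slope"
  by (simp_all add: path_exc_def numeral_eq_Suc)

section \<open>Closed form of the path excess\<close>

definition mu :: real where "mu = (1 - sqrt 5) / 2"

text \<open>\<open>(1 - 2 * slope) / slope\<close> is the golden ratio, so the dominant Fibonacci
  mode cancels and only the mode of \<open>mu\<close>, the conjugate root of
  \<open>x ^ 2 = x + 1\<close>, survives.\<close>

lemma path_cnt_slope: "slope * real (path_cnt (Suc n)) - (1 - 2 * slope) * real (path_cnt n)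
    = (4 * slope - 1) * mu ^ n"
proof (induction n)
  case (Suc n)
  have "slope * real (path_cnt (Suc (Suc n))) - (1 - 2 * slope) * real (path_cnt (Suc n))
     = mu * (slope * real (path_cnt (Suc n)) - (1 - 2 * slope) * real (path_cnt n))"
    by (simp add: slope_def mu_def field_simps)
  then show ?case using Suc by simp
qed simp

lemma path_tot_closed: "real (path_tot n) - (slope * real n + (3 - sqrt 5) / 5) * real (path_cnt n)
    = - (real n + 2) * mu ^ (n + 2) / 5"
proof (induction n rule: path_cnt.induct)
  case 1
  show ?case by (simp add: mu_def field_simps power2_eq_square)
next
  case 2
  show ?case by (simp add: mu_def slope_def field_simps eval_nat_numeral)
next
  case (3 n)
  define c where "c = (3 - sqrt 5) / 5"
  define W where "W k = real (path_tot k) - (slope * real k + c) * real (path_cnt k)" for k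
  \<comment> \<open>\<open>W\<close> obeys the Fibonacci recurrence with the forcing term of
    \<open>path_cnt_slope\<close>. As \<open>mu\<close> is itself a characteristic root, a factor
    linear in \<open>n\<close> appears in the closed form.\<close>
  have "W (Suc (Suc n)) = W (Suc n) + W n
      - (slope * real (path_cnt (Suc n)) - (1 - 2 * slope) * real (path_cnt n))"
    by (simp add: W_def algebra_simps)
  also have "\<dots> = - (real n + 3) * (mu * mu ^ 2 * mu ^ n) / 5 - (real n + 2) * (mu ^ 2 * mu ^ n) / 5
      - (4 * slope - 1) * mu ^ n"
  proof -
    have "W (Suc n) = - (real n + 3) * (mu * mu ^ 2 * mu ^ n) / 5"
      "W n = - (real n + 2) * (mu ^ 2 * mu ^ n) / 5"
      using 3 unfolding c_def[symmetric] W_def[symmetric] by (simp_all add: power_add power2_eq_square ac_simps)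
    then show ?thesis unfolding path_cnt_slope by linarith
  qed
  also have "\<dots> = - (real n + 4) * (mu ^ 2 * mu ^ 2 * mu ^ n) / 5"
  proof -
    have "- (real n + 3) * (mu * mu ^ 2) / 5 - (real n + 2) * mu ^ 2 / 5 - (4 * slope - 1)
        = - (real n + 4) * (mu ^ 2 * mu ^ 2) / 5"
      by (simp add: mu_def slope_def field_simps power2_eq_square)
    then have "(- (real n + 3) * (mu * mu ^ 2) / 5 - (real n + 2) * mu ^ 2 / 5 - (4 * slope - 1)) * mu ^ n
        = - (real n + 4) * (mu ^ 2 * mu ^ 2) / 5 * mu ^ n" by simp
    then show ?thesis by (simp add: algebra_simps)
  qed
  finally show ?case unfolding c_def[symmetric] W_def[symmetric]
    by (simp add: power_add algebra_simps power2_eq_square)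
qed

lemma path_exc_closed:
  "path_exc n = (3 - sqrt 5) / 5 - (real n + 2) * mu ^ (n + 2) / (5 * real (path_cnt n))"
proof -
  have "T / F - s = c - w / (5 * F)" if "T - (s + c) * F = - w / 5" "F > 0" for T s c F w :: real
  proof -
    have "T = ((s + c) - w / (5 * F)) * F" using that by (simp add: algebra_simps)
    then show ?thesis using that(2) by simp
  qed
  from this[OF path_tot_closed[of n, unfolded minus_mult_left[symmetric]]] show ?thesis
    by (simp add: path_exc_def)
qed

text \<open>The bound is the value at \<open>n = 4\<close>, where \<open>path_cnt 4 = 8\<close>.
  From there on the numerator decreases in absolute value, since the powers of \<open>mu\<close>
  decay faster than \<open>n + 2\<close> grows, and the denominator does not decrease.\<close>

lemma path_exc_dev:
  assumes "n \<ge> 4"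
  shows "\<bar>(real n + 2) * mu ^ (n + 2) / (5 * real (path_cnt n))\<bar> \<le> 6 * mu ^ 6 / 40"
proof -
  have mu: "\<bar>mu\<bar> \<le> 0.62" "mu \<noteq> 0" using sqrt5_bounds by (auto simp: mu_def)
  have "(real n + 2) * \<bar>mu\<bar> ^ (n + 2) \<le> 6 * \<bar>mu\<bar> ^ 6 \<and> path_cnt n \<ge> 8"
    using assms
  proof (induction n rule: dec_induct)
    case base
    then show ?case by (simp add: eval_nat_numeral)
  next
    case (step n)
    have "(real n + 3) * \<bar>mu\<bar> \<le> (real n + 2)"
      using mult_left_mono[OF mu(1), of "real n + 3"] step(1) by simp
    then have "((real n + 3) * \<bar>mu\<bar>) * \<bar>mu\<bar> ^ (n + 2) \<le> (real n + 2) * \<bar>mu\<bar> ^ (n + 2)"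
      by (intro mult_right_mono) auto
    moreover have "path_cnt (Suc n) \<ge> path_cnt n"
      by (cases n) auto
    ultimately show ?case using step by (simp add: algebra_simps)
  qed
  then have "(real n + 2) * \<bar>mu\<bar> ^ (n + 2) / (5 * real (path_cnt n)) \<le> 6 * \<bar>mu\<bar> ^ 6 / 40"
    by (intro frac_le) auto
  moreover have "\<bar>mu\<bar> ^ 6 = mu ^ 6" by (simp add: power_even_abs)
  ultimately show ?thesis by (simp add: abs_mult power_abs)
qed

lemma path_exc_ge4:
  assumes "n \<ge> 4"
  shows "path_exc n \<ge> path_exc 4" "path_exc n \<le> offset"
proof -
  \<comment> \<open>As \<open>mu ^ 6\<close> is positive, \<open>path_exc 4\<close> lies below the
    limit \<open>(3 - sqrt 5) / 5\<close> by exactly the maximal deviation. Its mirror image in the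
    limit is therefore an upper bound.\<close>
  have *: "path_exc 4 = (3 - sqrt 5) / 5 - 6 * mu ^ 6 / 40"
    unfolding path_exc_closed[of 4] by (simp add: eval_nat_numeral)
  show "path_exc n \<ge> path_exc 4"
    unfolding * using path_exc_closed[of n] path_exc_dev[OF assms] by linarith
  have "path_exc n \<le> 2 * ((3 - sqrt 5) / 5) - path_exc 4"
    unfolding * using path_exc_closed[of n] path_exc_dev[OF assms] by linarith
  also have "\<dots> \<le> offset"
    using sqrt5_bounds by (simp add: slope_def offset_def add_divide_distrib diff_divide_distrib)
  finally show "path_exc n \<le> offset" .
qed

lemma path_exc_ge3: "n \<ge> 3 \<Longrightarrow> path_exc n \<ge> 0.1444"
  using path_exc_ge4(1)[of n] slope_bounds by (cases "n = 3") auto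

lemma path_exc_ge: "n \<ge> 1 \<Longrightarrow> path_exc n \<ge> 0.1138"
  using path_exc_ge3[of n] slope_bounds
  by (cases "n = 1"; cases "n = 2") auto

section \<open>Ratios of consecutive path counts\<close>

lemma path_cnt_ratio:
  "2 * path_cnt n \<ge> path_cnt (Suc n)" "2 * path_cnt (Suc n) \<ge> 3 * path_cnt n"
  by (induction n rule: path_cnt.induct) auto

lemma path_cnt_ratio2: "n \<ge> 2 \<Longrightarrow> 5 * path_cnt n \<ge> 3 * path_cnt (Suc n)"
  using path_cnt_ratio[of "n - 2"] by (cases n rule: path_cnt.cases) auto

text \<open>For \<open>n >= 1\<close>, the fraction of the independent sets of a path with
  \<open>n\<close> vertices that avoid a given end.\<close>

definition path_ratio :: "nat \<Rightarrow> real" where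
  "path_ratio n = real (path_cnt (n - 1)) / real (path_cnt n)"

lemma path_ratio_le: "n \<ge> 1 \<Longrightarrow> path_ratio n \<le> 2 / 3"
  using path_cnt_ratio(2)[of "n - 1"] by (cases n) (auto simp: path_ratio_def field_simps)

lemma path_ratio_ge: "n \<ge> 3 \<Longrightarrow> path_ratio n \<ge> 3 / 5"
  using path_cnt_ratio2[of "n - 1"] by (cases n) (auto simp: path_ratio_def field_simps)

text \<open>
  In \<open>leg_ok e g f\<close>, \<open>e\<close> and \<open>g\<close> are the contributions of a path component to \<open>A\<close> and \<open>B\<close>, and \<open>f\<close> is
  its factor of \<open>t\<close>; the cases are lengths 1, 2 and at least 3. In \<open>rest_ok A B r\<close> these are the
  contributions of the exceptional component, with all constants included; the cases are: not a
  path (or a path with 3 vertices), and paths with 1, 2 and at least 4 vertices.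
\<close>

definition leg_ok :: "real \<Rightarrow> real \<Rightarrow> real \<Rightarrow> bool" where
  "leg_ok e g f \<longleftrightarrow> e \<ge> 0.2236 \<and> g \<ge> -0.2764 \<and> f = 1/2
     \<or> e \<ge> 0.1138 \<and> g \<ge> -0.0528 \<and> f = 2/3
     \<or> e \<ge> 0.1444 \<and> g \<ge> -0.1626 \<and> 3/5 \<le> f \<and> f \<le> 2/3"

definition rest_ok :: "real \<Rightarrow> real \<Rightarrow> real \<Rightarrow> bool" where
  "rest_ok A B r \<longleftrightarrow> A \<ge> -0.2764 \<and> B \<ge> 0.3945 \<and> 1/2 \<le> r \<and> r \<le> 1
     \<or> A \<ge> -0.2193 \<and> B \<ge> 0.2807 \<and> r = 1/2
     \<or> A \<ge> -0.3291 \<and> B \<ge> 0.5043 \<and> r = 2/3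
     \<or> A \<ge> -0.2985 \<and> B \<ge> 0.4250 \<and> 3/5 \<le> r \<and> r \<le> 1"

lemma leg_ok_path:
  assumes "n \<ge> 1"
  shows "leg_ok (path_exc n) (path_exc (n - 1) - slope) (path_ratio n)"
proof -
  consider "n = 1" | "n = 2" | "n \<ge> 3" using assms by linarith
  then show ?thesis
  proof cases
    case 3
    \<comment> \<open>The shortened path may have only 2 vertices, so just the weaker bound holds
      for it; \<open>-0.1626\<close> is \<open>0.1138 - 0.2764\<close>.\<close>
    then have "path_exc (n - 1) \<ge> 0.1138" by (intro path_exc_ge) simp
    then show ?thesis
      using path_exc_ge3[OF 3] path_ratio_le[OF assms] path_ratio_ge[OF 3] slope_bounds
      unfolding leg_ok_def by (intro disjI2 conjI) linarith+
  qed (use slope_bounds in \<open>simp_all add: leg_ok_def path_ratio_def numeral_2_eq_2[symmetric]\<close>,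
       simp_all add: numeral_2_eq_2)
qed

text \<open>Once \<open>A\<close> and \<open>B\<close> are replaced by lower bounds, the expression
  is affine in \<open>t\<close>, so the two ends of the range of \<open>t\<close> decide its
  sign.\<close>

lemma affine_nonneg:
  fixes A B t :: real
  assumes "Al \<le> A" "Bl \<le> B" "0 \<le> tlo" "tlo \<le> t" "t \<le> thi" "Al + tlo * Bl \<ge> 0" "Al + thi * Bl \<ge> 0"
  shows "A + t * B \<ge> 0"
proof -
  have "Al + t * Bl \<ge> 0"
  proof (cases "Bl \<ge> 0")
    case True
    then show ?thesis using mult_right_mono[OF assms(4), of Bl] assms by linarith
  next
    case False
    then show ?thesis using mult_right_mono_neg[OF assms(5), of Bl] assms by linarith
  qed
  moreover have "t * Bl \<le> t * B" using assms by (intro mult_left_mono) auto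
  ultimately show ?thesis using assms by linarith
qed

lemma affine_nonneg2:
  fixes A B r f f' :: real
  assumes "Al \<le> A" "Bl \<le> B" "0 \<le> rl" "rl \<le> r" "r \<le> rh" "0 \<le> fl" "fl \<le> f" "f \<le> fh"
    "0 \<le> fl'" "fl' \<le> f'" "f' \<le> fh'"
    "Al + (rl * (fl * fl')) * Bl \<ge> 0" "Al + (rh * (fh * fh')) * Bl \<ge> 0"
  shows "A + (r * (f * f')) * B \<ge> 0"
proof (rule affine_nonneg[OF assms(1,2) _ _ _ assms(12,13)])
  show "rl * (fl * fl') \<le> r * (f * f')" "r * (f * f') \<le> rh * (fh * fh')"
    using assms by (auto intro!: mult_mono)
qed (use assms in auto)

text \<open>A finite check: each hypothesis confines its data to one of a few boxes, named by
  \<open>P\<close> and \<open>L\<close>. For each of the 36 combinations, two numerical inequalities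
  at the extreme values of the product suffice.\<close>

lemma two_legs:
  assumes "rest_ok A B r" "leg_ok e g f" "leg_ok e' g' f'"
  shows "A + (e + e') + r * (f * f') * (B + (g + g')) \<ge> 0"
proof -
  define P where "P Al Bl rl rh \<longleftrightarrow> Al \<le> A \<and> Bl \<le> B \<and> rl \<le> r \<and> r \<le> rh" for Al Bl rl rh :: real
  define L where "L el gl fl fh e g f \<longleftrightarrow> el \<le> e \<and> gl \<le> g \<and> fl \<le> f \<and> f \<le> fh"
    for el gl fl fh e g f :: real
  have key: ?thesis if "P Al Bl rl rh" "L el gl fl fh e g f" "L el' gl' fl' fh' e' g' f'"
    "0 \<le> rl" "0 \<le> fl" "0 \<le> fl'"
    "Al + (el + el') + (rl * (fl * fl')) * (Bl + (gl + gl')) \<ge> 0"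
    "Al + (el + el') + (rh * (fh * fh')) * (Bl + (gl + gl')) \<ge> 0"
    for Al Bl rl rh el gl fl fh el' gl' fl' fh'
  proof (rule affine_nonneg2)
    show "Al + (el + el') \<le> A + (e + e')" "Bl + (gl + gl') \<le> B + (g + g')"
      using that(1,2,3) unfolding P_def L_def by linarith+
    show "rl \<le> r" "r \<le> rh" "fl \<le> f" "f \<le> fh" "fl' \<le> f'" "f' \<le> fh'"
      using that(1,2,3) unfolding P_def L_def by blast+
  qed (use that(4-8) in blast)+
  have 1: "P (-0.2764) 0.3945 (1/2) 1 \<or> P (-0.2193) 0.2807 (1/2) (1/2)
    \<or> P (-0.3291) 0.5043 (2/3) (2/3) \<or> P (-0.2985) 0.4250 (3/5) 1"
    using assms(1) unfolding rest_ok_def P_def by auto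
  have 2: "L 0.2236 (-0.2764) (1/2) (1/2) e g f \<or> L 0.1138 (-0.0528) (2/3) (2/3) e g f
    \<or> L 0.1444 (-0.1626) (3/5) (2/3) e g f" if "leg_ok e g f" for e g f
    using that unfolding leg_ok_def L_def by auto
  show ?thesis
    using 1 2[OF assms(2)] 2[OF assms(3)]
    by (elim disjE) ((rule key, assumption, assumption, assumption, simp_all; fail)+)
qed

text \<open>The bounds \<open>- 0.11\<close> and \<open>4 / 9\<close> serve only to make the induction on the legs go through.\<close>

lemma legs_nonneg:
  assumes "finite K" "card K \<ge> 2" "rest_ok A B r" "\<And>x. x \<in> K \<Longrightarrow> leg_ok (e x) (g x) (f x)"
  shows "A + sum e K + r * prod f K * (B + sum g K) \<ge> 0
    \<and> A + sum e K \<ge> - 0.11 \<and> 0 \<le> r * prod f K \<and> r * prod f K \<le> 4 / 9"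
  using assms(1,2,4)
proof (induction K rule: finite_induct)
  case (insert x K)
  note x = insert.prems(2)[of x, simplified]
  have r: "0 \<le> r" "r \<le> 1" "A \<ge> -0.3291" using assms(3) by (auto simp: rest_ok_def)
  have f: "0 \<le> f x" "f x \<le> 2/3" using x by (auto simp: leg_ok_def)
  show ?case
  proof (cases "card K \<ge> 2")
    \<comment> \<open>Exactly two legs. The extra bounds hold because
      \<open>-0.3291 + 2 * 0.1138\<close> exceeds \<open>-0.11\<close> and the three factors are at
      most \<open>1\<close>, \<open>2 / 3\<close> and \<open>2 / 3\<close>.\<close>
    case False
    then obtain y where K: "K = {y}" using insert 
      by (metis One_nat_def Suc_le_mono card_1_singletonE card_insert_disjoint le_antisym not_less_eq_eq numeral_2_eq_2)
    have y: "leg_ok (e y) (g y) (f y)" using insert.prems(2) K by simp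
    have fy: "0 \<le> f y" "f y \<le> 2/3" using y by (auto simp: leg_ok_def)
    then have "f x * f y \<le> (2/3) * (2/3)" using f fy by (intro mult_mono) auto
    then have "r * (f x * f y) \<le> 1 * ((2/3) * (2/3))" using r f fy by (intro mult_mono) auto
    moreover have "e x \<ge> 0.1138" "e y \<ge> 0.1138" using x y by (auto simp: leg_ok_def)
    ultimately show ?thesis
      using two_legs[OF assms(3) x y] r f fy insert.hyps K by simp
  next
    case True
    define A' t B' where "A' = A + sum e K" and "t = r * prod f K" and "B' = B + sum g K"
    have IH: "A' + t * B' \<ge> 0" "A' \<ge> -0.11" "0 \<le> t" "t \<le> 4/9"
      using insert.IH[OF True] insert.prems(2) by (simp_all add: A'_def t_def B'_def)
    \<comment> \<open>The expression for the smaller set is split off with weight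
      \<open>f x\<close>; the remainder no longer involves \<open>B'\<close>.\<close>
    have *: "A' + e x + f x * t * (B' + g x)
      = f x * (A' + t * B') + (1 - f x) * A' + e x + f x * t * g x" by (simp add: algebra_simps)
    have 1: "f x * (A' + t * B') \<ge> 0" using f IH by simp
    have 2: "(1 - f x) * A' + e x + f x * t * g x \<ge> 0"
    proof -
      have "0 \<le> (1 - f x) * (A' + 11/100)" using f IH by (intro mult_nonneg_nonneg) auto
      also have "\<dots> = (1 - f x) * A' + 11/100 - (11/100) * f x" by algebra
      finally have p: "(1 - f x) * A' \<ge> (11/100) * f x - 11/100" by linarith
      have q: "f x * t * g x \<ge> f x * (4/9) * m"
        if "m \<le> g x" "m \<le> 0" for m
      proof -
        have "f x * t * g x \<ge> f x * t * m" using that f IH by (intro mult_left_mono) auto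
        moreover have "f x * t * m \<ge> f x * (4/9) * m"
          using that f IH by (intro mult_right_mono_neg mult_left_mono) auto
        ultimately show ?thesis by linarith
      qed
      define P Q where "P = (1 - f x) * A'" and "Q = f x * t * g x"
      note p = p[folded P_def] and q = q[folded Q_def]
      \<comment> \<open>The excess \<open>e x\<close> outweighs both losses. The bound on
        \<open>P\<close> is worst for the smallest \<open>f x\<close>, the bound on \<open>Q\<close>
        for the largest.\<close>
      have "0 \<le> P + e x + Q" using x unfolding leg_ok_def
      proof (elim disjE conjE)
        assume *: "e x \<ge> 0.2236" "g x \<ge> -0.2764" "f x = 1/2"
        have "P \<ge> -0.055" using p unfolding *(3) by simp
        moreover have "Q \<ge> -0.0615" using q[OF *(2)] unfolding *(3) by simp
        ultimately show ?thesis using *(1) by simp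
      next
        assume *: "e x \<ge> 0.1138" "g x \<ge> -0.0528" "f x = 2/3"
        have "P \<ge> -0.037" using p unfolding *(3) by simp
        moreover have "Q \<ge> -0.016" using q[OF *(2)] unfolding *(3) by simp
        ultimately show ?thesis using *(1) by simp
      next
        assume *: "e x \<ge> 0.1444" "g x \<ge> -0.1626" "3/5 \<le> f x" "f x \<le> 2/3"
        have "P \<ge> -0.044" using p *(3) by simp
        moreover have "Q \<ge> -0.049" using q[OF *(2)] *(4) by simp
        ultimately show ?thesis using *(1) by simp
      qed
      then show ?thesis by (simp add: P_def Q_def)
    qed
    have "A' + e x + f x * t * (B' + g x) \<ge> 0" unfolding * using 1 2 by linarith
    moreover have "e x \<ge> 0" using x by (auto simp: leg_ok_def)
    moreover have "f x * t \<le> 1 * (4/9)" using f IH by (intro mult_mono) auto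
    moreover have "0 \<le> f x * t" using f IH by simp
    ultimately have "A' + e x + f x * t * (B' + g x) \<ge> 0 \<and> A' + e x \<ge> -0.11 \<and> 0 \<le> f x * t \<and> f x * t \<le> 4/9"
      using IH(2) by simp
    then show ?thesis using insert.hyps by (simp add: A'_def t_def B'_def algebra_simps)
  qed
qed simp

section \<open>Independent sets\<close>

text \<open>The edge relation is fixed once and an induced subgraph is represented by its vertex set
  alone, so deleting vertices is set difference.\<close>

locale simple_graph =
  fixes E :: "'a rel"
  assumes sym: "(u, v) \<in> E \<Longrightarrow> (v, u) \<in> E"
    and irrefl: "(v, v) \<notin> E"
begin

definition ind :: "'a set \<Rightarrow> 'a set set" where
  "ind S = {X. X \<subseteq> S \<and> pairwise (\<lambda>u v. (u, v) \<notin> E) X}"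

definition cnt :: "'a set \<Rightarrow> nat" where
  "cnt S = card (ind S)"

definition tot :: "'a set \<Rightarrow> nat" where
  "tot S = (\<Sum>X\<in>ind S. card X)"

definition exc :: "'a set \<Rightarrow> real" where
  "exc S = real (tot S) / real (cnt S) - slope * real (card S)"

definition nonadj :: "'a set \<Rightarrow> 'a set \<Rightarrow> bool" where
  "nonadj S R \<longleftrightarrow> S \<inter> R = {} \<and> (\<forall>u\<in>S. \<forall>v\<in>R. (u, v) \<notin> E)"

lemma finite_ind: "finite S \<Longrightarrow> finite (ind S)"
  by (simp add: ind_def)

lemma empty_in_ind [simp]: "{} \<in> ind S"
  by (simp add: ind_def)

lemma cnt_pos: "finite S \<Longrightarrow> 0 < cnt S"
  unfolding cnt_def by (metis card_gt_0_iff empty_iff empty_in_ind finite_ind)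

lemma ind_empty: "ind {} = {{}}"
  by (auto simp: ind_def)

lemma cnt_empty [simp]: "cnt {} = 1" and tot_empty [simp]: "tot {} = 0"
  by (simp_all add: cnt_def tot_def ind_empty)

lemma exc_empty [simp]: "exc {} = 0"
  by (simp add: exc_def)

text \<open>Independent sets containing \<open>v\<close> arise by inserting \<open>v\<close> into
  those that avoid \<open>v\<close> and all its neighbours. The arbitrary weight \<open>g\<close>
  lets one argument serve both \<open>cnt\<close> and \<open>tot\<close>.\<close>

lemma sum_ind_rec:
  fixes g :: "'a set \<Rightarrow> nat"
  assumes "finite S" "v \<in> S"
  shows "sum g (ind S) = sum g (ind (S - {v})) + (\<Sum>X\<in>ind (S - {v} - E `` {v}). g (insert v X))"
proof -
  let ?R = "S - {v} - E `` {v}"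
  have "ind S = ind (S - {v}) \<union> insert v ` ind ?R"
  proof (intro equalityI subsetI)
    fix X assume X: "X \<in> ind S"
    show "X \<in> ind (S - {v}) \<union> insert v ` ind ?R"
    proof (cases "v \<in> X")
      case True
      then have "X - {v} \<in> ind ?R" "X = insert v (X - {v})"
        using X irrefl by (auto simp: ind_def pairwise_def)
      then show ?thesis by blast
    qed (use X in \<open>auto simp: ind_def\<close>)
  next
    fix X assume "X \<in> ind (S - {v}) \<union> insert v ` ind ?R"
    then consider "X \<in> ind (S - {v})" | Y where "Y \<in> ind ?R" "X = insert v Y" by blast
    then show "X \<in> ind S"
    proof cases
      case 2
      then have "Y \<subseteq> S" "pairwise (\<lambda>u v. (u, v) \<notin> E) Y" "\<And>y. y \<in> Y \<Longrightarrow> (v, y) \<notin> E"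
        by (auto simp: ind_def)
      then show ?thesis using 2 assms(2) sym by (auto simp: ind_def pairwise_insert)
    qed (auto simp: ind_def)
  qed
  moreover have "ind (S - {v}) \<inter> insert v ` ind ?R = {}"
    by (auto simp: ind_def)
  moreover have "inj_on (insert v) (ind ?R)"
  proof (rule inj_onI)
    fix X Y assume "X \<in> ind ?R" "Y \<in> ind ?R" "insert v X = insert v Y"
    moreover from this have "v \<notin> X" "v \<notin> Y" by (auto simp: ind_def)
    ultimately show "X = Y" by (simp add: insert_ident)
  qed
  ultimately show ?thesis
    using assms by (simp add: sum.union_disjoint finite_ind sum.reindex)
qed

lemma
  assumes "finite S" "v \<in> S"
  shows cnt_rec: "cnt S = cnt (S - {v}) + cnt (S - {v} - E `` {v})"
    and tot_rec: "tot S = tot (S - {v}) + tot (S - {v} - E `` {v}) + cnt (S - {v} - E `` {v})"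
proof -
  show "cnt S = cnt (S - {v}) + cnt (S - {v} - E `` {v})"
    using sum_ind_rec[OF assms, of "\<lambda>_. 1"] by (simp add: cnt_def)
  have "(\<Sum>X\<in>ind (S - {v} - E `` {v}). card (insert v X)) = (\<Sum>X\<in>ind (S - {v} - E `` {v}). card X + 1)"
  proof (rule sum.cong[OF refl])
    fix X assume "X \<in> ind (S - {v} - E `` {v})"
    then have "v \<notin> X" "finite X" using assms finite_subset by (auto simp: ind_def)
    then show "card (insert v X) = card X + 1" by simp
  qed
  also have "\<dots> = tot (S - {v} - E `` {v}) + cnt (S - {v} - E `` {v})"
    unfolding tot_def cnt_def sum.distrib by simp
  finally show "tot S = tot (S - {v}) + tot (S - {v} - E `` {v}) + cnt (S - {v} - E `` {v})"
    using sum_ind_rec[OF assms, of card] by (simp add: tot_def)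
qed

lemma cnt_mono: "finite S \<Longrightarrow> R \<subseteq> S \<Longrightarrow> cnt R \<le> cnt S"
  unfolding cnt_def by (intro card_mono finite_ind) (auto simp: ind_def)

lemma ratio_bounds:
  assumes "finite S" "v \<in> S"
  shows "1 / 2 \<le> real (cnt (S - {v})) / real (cnt S)" "real (cnt (S - {v})) / real (cnt S) \<le> 1"
proof -
  have "cnt (S - {v} - E `` {v}) \<le> cnt (S - {v})" using assms by (intro cnt_mono) auto
  then show "1 / 2 \<le> real (cnt (S - {v})) / real (cnt S)" "real (cnt (S - {v})) / real (cnt S) \<le> 1"
    using cnt_rec[OF assms] cnt_pos[OF assms(1)] by (auto simp: field_simps)
qed

lemma
  assumes "finite S" "finite R" "nonadj S R"
  shows cnt_Un: "cnt (S \<union> R) = cnt S * cnt R"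
    and tot_Un: "tot (S \<union> R) = tot S * cnt R + cnt S * tot R"
proof -
  have "bij_betw (\<lambda>(X, Y). X \<union> Y) (ind S \<times> ind R) (ind (S \<union> R))"
  proof (rule bij_betw_byWitness[where f' = "\<lambda>X. (X \<inter> S, X \<inter> R)"])
    show "(\<lambda>(X, Y). X \<union> Y) ` (ind S \<times> ind R) \<subseteq> ind (S \<union> R)"
    proof clarify
      fix X Y assume XY: "X \<in> ind S" "Y \<in> ind R"
      then have "(u, v) \<notin> E \<and> (v, u) \<notin> E" if "u \<in> X" "v \<in> Y" for u v
        using that assms(3) sym[of v u] unfolding ind_def nonadj_def by blast
      then show "X \<union> Y \<in> ind (S \<union> R)"
        using XY unfolding ind_def pairwise_def by blast
    qed
    show "(\<lambda>X. (X \<inter> S, X \<inter> R)) ` ind (S \<union> R) \<subseteq> ind S \<times> ind R"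
      by (auto simp: ind_def pairwise_def)
    show "\<forall>p\<in>ind S \<times> ind R. ((case p of (X, Y) \<Rightarrow> X \<union> Y) \<inter> S, (case p of (X, Y) \<Rightarrow> X \<union> Y) \<inter> R) = p"
      using assms(3) by (auto simp: ind_def nonadj_def)
    show "\<forall>X\<in>ind (S \<union> R). (case (X \<inter> S, X \<inter> R) of (X, Y) \<Rightarrow> X \<union> Y) = X"
      by (auto simp: ind_def)
  qed
  note bij = this
  show "cnt (S \<union> R) = cnt S * cnt R"
    using bij_betw_same_card[OF bij] by (simp add: cnt_def card_cartesian_product)
  have "tot (S \<union> R) = (\<Sum>(X, Y)\<in>ind S \<times> ind R. card (X \<union> Y))"
    using sum.reindex_bij_betw[OF bij, of card] by (simp add: tot_def case_prod_unfold)
  also have "\<dots> = (\<Sum>(X, Y)\<in>ind S \<times> ind R. card X + card Y)"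
  proof (rule sum.cong[OF refl], clarify)
    fix X Y assume "X \<in> ind S" "Y \<in> ind R"
    then show "card (X \<union> Y) = card X + card Y"
      using assms finite_subset by (intro card_Un_disjoint) (auto simp: ind_def nonadj_def)
  qed
  also have "\<dots> = tot S * cnt R + cnt S * tot R"
    by (simp add: sum.cartesian_product[symmetric] sum.distrib tot_def cnt_def sum_distrib_left mult.commute)
  finally show "tot (S \<union> R) = tot S * cnt R + cnt S * tot R" .
qed

text \<open>An independent set of the union is a free choice of one in each part, so the average
  sizes add; the cardinalities add as well.\<close>

lemma exc_Un:
  assumes "finite S" "finite R" "nonadj S R"
  shows "exc (S \<union> R) = exc S + exc R"
proof -
  have "card (S \<union> R) = card S + card R"
    using assms by (intro card_Un_disjoint) (auto simp: nonadj_def)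
  then show ?thesis
    using cnt_pos[OF assms(1)] cnt_pos[OF assms(2)]
    by (simp add: exc_def cnt_Un[OF assms] tot_Un[OF assms] add_divide_distrib distrib_left)
qed

lemma cnt_exc_UNION:
  assumes "finite K" "\<And>x. x \<in> K \<Longrightarrow> finite (C x)"
    "\<And>x y. x \<in> K \<Longrightarrow> y \<in> K \<Longrightarrow> x \<noteq> y \<Longrightarrow> nonadj (C x) (C y)"
  shows "cnt (\<Union>x\<in>K. C x) = (\<Prod>x\<in>K. cnt (C x)) \<and> exc (\<Union>x\<in>K. C x) = (\<Sum>x\<in>K. exc (C x))"
  using assms
proof (induction K rule: finite_induct)
  case (insert x K)
  have *: "nonadj (C x) (\<Union>x\<in>K. C x)"
    using insert.prems(2)[of x] insert.hyps by (fastforce simp: nonadj_def)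
  have "cnt (\<Union>x\<in>K. C x) = (\<Prod>x\<in>K. cnt (C x)) \<and> exc (\<Union>x\<in>K. C x) = (\<Sum>x\<in>K. exc (C x))"
    using insert by simp
  then show ?case
    using insert.hyps insert.prems(1) cnt_Un[OF _ _ *] exc_Un[OF _ _ *] by simp
qed simp

section \<open>Trees\<close>

text \<open>The closure is reflexive, so \<open>x\<close> belongs to its component even when it is
  not in \<open>R\<close>; containment in \<open>R\<close> thus requires \<open>x\<close> in
  \<open>R\<close>.\<close>

definition component :: "'a set \<Rightarrow> 'a \<Rightarrow> 'a set" where
  "component R x = (E \<inter> R \<times> R)\<^sup>* `` {x}"

lemma self_in_comp [simp]: "x \<in> component R x"
  by (simp add: component_def)

lemma comp_subset: "x \<in> R \<Longrightarrow> component R x \<subseteq> R"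
  by (auto simp: component_def elim: rtranclE)

lemma comp_sym: "y \<in> component R x \<Longrightarrow> x \<in> component R y"
proof -
  have "Relation.sym (E \<inter> R \<times> R)" using sym by (auto intro: symI)
  then show "y \<in> component R x \<Longrightarrow> x \<in> component R y"
    unfolding component_def by (auto dest: sym_rtrancl symD)
qed

lemma comp_trans: "y \<in> component R x \<Longrightarrow> z \<in> component R y \<Longrightarrow> z \<in> component R x"
  by (auto simp: component_def)

lemma comp_step: "y \<in> component R x \<Longrightarrow> (y, z) \<in> E \<Longrightarrow> x \<in> R \<Longrightarrow> z \<in> R \<Longrightarrow> z \<in> component R x"
  using comp_subset[of x R] by (auto simp: component_def intro: rtrancl_into_rtrancl)

lemma comp_mono: "R \<subseteq> T \<Longrightarrow> component R x \<subseteq> component T x"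
  unfolding component_def by (intro Image_mono rtrancl_mono) auto

lemma comp_idem:
  assumes "x \<in> R"
  shows "component R x \<subseteq> component (component R x) x"
proof
  fix y assume "y \<in> component R x"
  then have "(x, y) \<in> (E \<inter> R \<times> R)\<^sup>*" by (simp add: component_def)
  then show "y \<in> component (component R x) x"
  proof (induction rule: rtrancl_induct)
    case (step y z)
    then have "y \<in> component R x" "z \<in> component R x"
      by (auto simp: component_def intro: rtrancl_into_rtrancl)
    then show ?case using step comp_step by auto
  qed simp
qed

lemma comp_subset_comp: "x \<in> R \<Longrightarrow> component R x \<subseteq> T \<Longrightarrow> component R x \<subseteq> component T x"
  using comp_idem comp_mono by blast

text \<open>Acyclicity is expressed without cycles: deleting a vertex puts its neighbours into
  different components. This is the form needed for conditioning on a vertex.\<close>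

definition tree_on :: "'a set \<Rightarrow> bool" where
  "tree_on S \<longleftrightarrow> finite S \<and> S \<noteq> {} \<and> (\<forall>x\<in>S. S \<subseteq> component S x) \<and>
     (\<forall>v\<in>S. \<forall>x\<in>S \<inter> E `` {v}. \<forall>y\<in>S \<inter> E `` {v}. y \<in> component (S - {v}) x \<longrightarrow> x = y)"

text \<open>Neighbours stay separated because components only shrink when vertices are removed, and
  a walk inside a component never leaves it.\<close>

lemma tree_comp:
  assumes "tree_on S" "R \<subseteq> S" "x \<in> R"
  shows "tree_on (component R x)"
proof -
  have sub: "component R x \<subseteq> R" using assms by (simp add: comp_subset)
  have "z \<in> component (component R x) y" if "y \<in> component R x" "z \<in> component R x" for y z
    using that comp_idem[OF assms(3)] by (blast intro: comp_trans comp_sym)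
  moreover have "a = b" if "v \<in> component R x" "a \<in> component R x \<inter> E `` {v}" "b \<in> component R x \<inter> E `` {v}"
    "b \<in> component (component R x - {v}) a" for v a b
  proof -
    have "b \<in> component (S - {v}) a" using that(4) comp_mono[of "component R x - {v}" "S - {v}" a] sub assms(2) by blast
    then show ?thesis using that assms sub unfolding tree_on_def by blast
  qed
  moreover have "component R x \<noteq> {}" using self_in_comp by blast
  moreover have "finite (component R x)"
    using assms sub unfolding tree_on_def by (meson finite_subset)
  ultimately show ?thesis unfolding tree_on_def by blast
qed

lemma
  assumes "tree_on S" "v \<in> S"
  shows tree_split: "S - {v} = (\<Union>x\<in>S \<inter> E `` {v}. component (S - {v}) x)"
    and tree_split': "S - {v} - E `` {v} = (\<Union>x\<in>S \<inter> E `` {v}. component (S - {v}) x - {x})"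
    and tree_split_nonadj: "\<And>x y. x \<in> S \<inter> E `` {v} \<Longrightarrow> y \<in> S \<inter> E `` {v} \<Longrightarrow> x \<noteq> y \<Longrightarrow>
      nonadj (component (S - {v}) x) (component (S - {v}) y)"
    and tree_split_nbr: "\<And>x. x \<in> S \<inter> E `` {v} \<Longrightarrow> component (S - {v}) x \<inter> E `` {v} = {x}"
proof -
  let ?C = "component (S - {v})" and ?K = "S \<inter> E `` {v}"
  have sub: "?C x \<subseteq> S - {v}" if "x \<in> ?K" for x
    using that irrefl by (intro comp_subset) auto
  have uniq: "x = y" if "x \<in> ?K" "y \<in> ?K" "y \<in> ?C x" for x y
    using that assms unfolding tree_on_def by blast
  show nbr: "?C x \<inter> E `` {v} = {x}" if "x \<in> ?K" for x
    using that sub[OF that] uniq[OF that] by auto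
  have "z = v \<or> z \<in> (\<Union>x\<in>?K. ?C x)" if "z \<in> S" for z
  proof -
    have "(v, z) \<in> (E \<inter> S \<times> S)\<^sup>*" using assms that by (auto simp: tree_on_def component_def)
    \<comment> \<open>Follow a walk from \<open>v\<close>: a step out of \<open>v\<close> enters the
      component of a neighbour, and any other step either stays in the current component or returns
      to \<open>v\<close>.\<close>
    then show ?thesis
    proof (induction rule: rtrancl_induct)
      case (step y z)
      show ?case
      proof (cases "y = v \<or> z = v")
        case True
        then have "z = v \<or> z \<in> ?K \<and> z \<in> ?C z" using step by auto
        then show ?thesis by blast
      next
        case False
        then obtain x where "x \<in> ?K" "y \<in> ?C x" using step by auto
        then have "z \<in> ?C x" using comp_step[of y "S - {v}" x z] step False irrefl by auto
        then show ?thesis using \<open>x \<in> ?K\<close> by blast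
      qed
    qed simp
  qed
  then show split: "S - {v} = (\<Union>x\<in>?K. ?C x)" using sub by blast
  show "S - {v} - E `` {v} = (\<Union>x\<in>?K. ?C x - {x})"
  proof -
    have "S - {v} - E `` {v} = (\<Union>x\<in>?K. ?C x - E `` {v})" using split by blast
    also have "\<dots> = (\<Union>x\<in>?K. ?C x - {x})" using nbr by (intro SUP_cong) blast+
    finally show ?thesis .
  qed
  show "nonadj (?C x) (?C y)" if "x \<in> ?K" "y \<in> ?K" "x \<noteq> y" for x y
  proof -
    have disj: "p \<notin> ?C y" if "p \<in> ?C x" for p
      using that \<open>x \<noteq> y\<close> uniq[OF \<open>x \<in> ?K\<close> \<open>y \<in> ?K\<close>] by (meson comp_trans comp_sym)
    moreover have "(p, q) \<notin> E" if "p \<in> ?C x" "q \<in> ?C y" for p q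
    proof
      assume "(p, q) \<in> E"
      then have "q \<in> ?C x" using comp_step[OF \<open>p \<in> ?C x\<close>, of q] that \<open>x \<in> ?K\<close> sub[OF \<open>y \<in> ?K\<close>] irrefl by auto
      then show False using disj that by blast
    qed
    ultimately show ?thesis unfolding nonadj_def by blast
  qed
qed

text \<open>For \<open>v\<close> in \<open>S\<close>, the probability that a uniformly random
  independent set of \<open>S\<close> avoids \<open>v\<close>.\<close>

definition ratio :: "'a set \<Rightarrow> 'a \<Rightarrow> real" where
  "ratio S v = real (cnt (S - {v})) / real (cnt S)"

text \<open>Independent sets with and without \<open>v\<close> occur in the proportion
  \<open>t : 1\<close>, so the excess is a weighted mean of the two conditional ones. Given
  \<open>v\<close>, the summand \<open>1\<close> is \<open>v\<close> itself, and each excluded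
  neighbour costs \<open>slope\<close> because it still counts in \<open>card S\<close>.\<close>

lemma
  fixes c :: real
  assumes "tree_on S" "v \<in> S"
  defines "K \<equiv> S \<inter> E `` {v}" and "C \<equiv> component (S - {v})"
  defines "t \<equiv> \<Prod>x\<in>K. ratio (C x) x"
  shows tree_exc_rec: "(1 + t) * (exc S - c) = (\<Sum>x\<in>K. exc (C x)) - slope - c
      + t * ((\<Sum>x\<in>K. exc (C x - {x}) - slope) + 1 - slope - c)"
    and tree_ratio_rec: "ratio S v = 1 / (1 + t)"
    and tree_exc_minus: "exc (S - {v}) = (\<Sum>x\<in>K. exc (C x))"
proof -
  have fin: "finite S" "finite K" using assms by (auto simp: tree_on_def)
  have CS: "C x \<subseteq> S - {v}" if "x \<in> K" for x
    using that irrefl unfolding C_def K_def by (intro comp_subset) auto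
  have finC: "finite (C x)" if "x \<in> K" for x
    using CS[OF that] fin by (meson finite_Diff finite_subset)
  have na: "nonadj (C x) (C y)" if "x \<in> K" "y \<in> K" "x \<noteq> y" for x y
    using tree_split_nonadj[OF assms(1,2)] that unfolding K_def C_def by blast
  have na': "nonadj (C x - {x}) (C y - {y})" if "x \<in> K" "y \<in> K" "x \<noteq> y" for x y
    using na[OF that] by (auto simp: nonadj_def)
  have SC: "S - {v} = (\<Union>x\<in>K. C x)" "S - {v} - E `` {v} = (\<Union>x\<in>K. C x - {x})"
    using tree_split[OF assms(1,2)] tree_split'[OF assms(1,2)] unfolding K_def C_def by auto
  \<comment> \<open>\<open>P\<close> counts the independent sets avoiding \<open>v\<close>, and
    \<open>Q\<close> those containing it.\<close>
  define P Q where "P = cnt (S - {v})" and "Q = cnt (S - {v} - E `` {v})"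
  have "P = (\<Prod>x\<in>K. cnt (C x))"
    unfolding P_def SC(1) using cnt_exc_UNION[of K C] fin finC na by auto
  moreover have "Q = (\<Prod>x\<in>K. cnt (C x - {x}))"
    unfolding Q_def SC(2) using cnt_exc_UNION[of K "\<lambda>x. C x - {x}"] fin finC na' by auto
  ultimately have t: "t = real Q / real P" by (simp add: t_def ratio_def prod_dividef)
  have P: "P > 0" "Q > 0" using fin by (auto simp: P_def Q_def cnt_pos)
  have cS: "cnt S = P + Q" using cnt_rec fin assms by (simp add: P_def Q_def)
  show "ratio S v = 1 / (1 + t)"
    unfolding ratio_def P_def[symmetric] cS t using P by (simp add: field_simps)
  show e1: "exc (S - {v}) = (\<Sum>x\<in>K. exc (C x))"
    unfolding SC(1) using cnt_exc_UNION[of K C] fin finC na by auto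
  have e2: "exc (S - {v} - E `` {v}) = (\<Sum>x\<in>K. exc (C x - {x}))"
    unfolding SC(2) using cnt_exc_UNION[of K "\<lambda>x. C x - {x}"] fin finC na' by auto
  have "S - {v} - E `` {v} = S - {v} - K" by (auto simp: K_def)
  moreover have "K \<subseteq> S - {v}" using irrefl by (auto simp: K_def)
  ultimately have "card (S - {v} - E `` {v}) + card K = card (S - {v})"
    using card_Diff_subset[of K "S - {v}"] card_mono[of "S - {v}" K] fin by simp
  moreover have "card (S - {v}) + 1 = card S" using card_Suc_Diff1[OF fin(1) assms(2)] by simp
  ultimately have n: "real (card (S - {v})) = real (card S) - 1"
    "real (card (S - {v} - E `` {v})) = real (card S) - 1 - real (card K)" by linarith+
  have T: "real (tot (S - {v})) = (exc (S - {v}) + slope * (real (card S) - 1)) * real P"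
    "real (tot (S - {v} - E `` {v})) = (exc (S - {v} - E `` {v}) + slope * (real (card S) - 1 - real (card K))) * real Q"
    using P by (simp_all add: exc_def P_def[symmetric] Q_def[symmetric] n)
  have "real (cnt S) * (exc S + slope * real (card S)) = real (tot S)"
    using P cS by (simp add: exc_def)
  also have "\<dots> = real (tot (S - {v})) + real (tot (S - {v} - E `` {v})) + real Q"
    using tot_rec fin assms by (simp add: Q_def)
  finally have "(real P + real Q) * (exc S - c) = real P * (exc (S - {v}) - slope - c)
     + real Q * (exc (S - {v} - E `` {v}) - slope * real (card K) + 1 - slope - c)"
    unfolding T cS by (simp add: algebra_simps)
  then have "(real P + real Q) * (exc S - c) / real P = (exc (S - {v}) - slope - c)
     + t * (exc (S - {v} - E `` {v}) - slope * real (card K) + 1 - slope - c)"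
    using P by (simp add: t field_simps)
  moreover have "(real P + real Q) * (exc S - c) / real P = (1 + t) * (exc S - c)"
    using P by (simp add: t field_simps)
  ultimately show "(1 + t) * (exc S - c) = (\<Sum>x\<in>K. exc (C x)) - slope - c
      + t * ((\<Sum>x\<in>K. exc (C x - {x}) - slope) + 1 - slope - c)"
    unfolding e1 e2 by (simp add: sum_subtractf algebra_simps)
qed

section \<open>Paths rooted at an end\<close>

inductive leg :: "'a set \<Rightarrow> 'a \<Rightarrow> bool" where
  single: "leg {x} x"
| extend: "leg D y \<Longrightarrow> x \<notin> D \<Longrightarrow> D \<inter> E `` {x} = {y} \<Longrightarrow> leg (insert x D) x"

lemma leg_finite: "leg D x \<Longrightarrow> finite D \<and> x \<in> D"
  by (induction rule: leg.induct) auto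

text \<open>Deleting the new root leaves \<open>D\<close>; deleting its neighbour \<open>y\<close>
  too leaves \<open>D - {y}\<close>. The induction therefore carries the values with and without the
  root, matching the two-step recursion.\<close>

lemma leg_counts:
  "leg D x \<Longrightarrow> \<exists>n. card D = Suc n \<and> cnt D = path_cnt (Suc n) \<and> cnt (D - {x}) = path_cnt n
     \<and> tot D = path_tot (Suc n) \<and> tot (D - {x}) = path_tot n"
proof (induction rule: leg.induct)
  case (single x)
  then show ?case using cnt_rec[of "{x}" x] tot_rec[of "{x}" x] by simp
next
  case (extend D y x)
  have fin: "finite D" "y \<in> D" using leg_finite extend by auto
  obtain n where n: "card D = Suc n" "cnt D = path_cnt (Suc n)" "cnt (D - {y}) = path_cnt n"
     "tot D = path_tot (Suc n)" "tot (D - {y}) = path_tot n" using extend.IH by blast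
  have D: "insert x D - {x} = D" "D - E `` {x} = D - {y}" using extend by auto
  have "cnt (insert x D) = path_cnt (Suc (Suc n))" "tot (insert x D) = path_tot (Suc (Suc n))"
    using cnt_rec[of "insert x D" x] tot_rec[of "insert x D" x] fin unfolding D by (simp_all add: n)
  moreover have "card (insert x D) = Suc (Suc n)" using fin extend n by simp
  ultimately show ?case unfolding D using n by blast
qed

lemma
  assumes "leg D x"
  shows leg_exc: "exc D = path_exc (card D)"
    and leg_exc': "exc (D - {x}) = path_exc (card D - 1)"
    and leg_ratio: "ratio D x = path_ratio (card D)"
    and leg_card: "card D \<ge> 1"
  using leg_counts[OF assms] leg_finite[OF assms]
  by (auto simp: exc_def path_exc_def ratio_def path_ratio_def)

text \<open>Strip the end \<open>x\<close>: its only neighbour loses \<open>x\<close> and so keeps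
  at most one neighbour, making it an end of the remaining tree.\<close>

lemma tree_leg:
  assumes "tree_on D" "x \<in> D" "\<And>u. u \<in> D \<Longrightarrow> card (D \<inter> E `` {u}) \<le> 2" "card (D \<inter> E `` {x}) \<le> 1"
  shows "leg D x"
  using assms
proof (induction "card D" arbitrary: D x rule: less_induct)
  case less
  have fin: "finite D" using less by (simp add: tree_on_def)
  show ?case
  proof (cases "D \<inter> E `` {x} = {}")
    case True
    then have "D - {x} = {}" using tree_split[OF less.prems(1,2)] by simp
    then have "D = {x}" using less by blast
    then show ?thesis by (simp add: single)
  next
    case False
    then have "card (D \<inter> E `` {x}) = 1" using less.prems(4) fin
      by (metis One_nat_def card_0_eq finite_Int le_SucE le_zero_eq)
    then obtain y where y: "D \<inter> E `` {x} = {y}" by (auto simp: card_1_singleton_iff)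
    have D: "D - {x} = component (D - {x}) y" using tree_split[OF less.prems(1,2)] y by simp
    have yD: "y \<in> D - {x}" using y irrefl by auto
    have "leg (D - {x}) y"
    proof (rule less.hyps)
      show "card (D - {x}) < card D" using fin less.prems(2) by (rule card_Diff1_less)
      show "tree_on (D - {x})" using tree_comp[OF less.prems(1), of "D - {x}" y] D yD by auto
      show "card ((D - {x}) \<inter> E `` {u}) \<le> 2" if "u \<in> D - {x}" for u
      proof -
        have "card ((D - {x}) \<inter> E `` {u}) \<le> card (D \<inter> E `` {u})" using fin by (intro card_mono) auto
        then show ?thesis using less.prems(3)[of u] that by simp
      qed
      have "x \<in> D \<inter> E `` {y}" using y sym less.prems(2) by auto
      then have "card (D \<inter> E `` {y} - {x}) = card (D \<inter> E `` {y}) - 1" using fin by (simp add: card_Diff_singleton)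
      moreover have "(D - {x}) \<inter> E `` {y} = D \<inter> E `` {y} - {x}" by auto
      ultimately show "card ((D - {x}) \<inter> E `` {y}) \<le> 1" using less.prems(3)[of y] yD by simp
    qed (use yD in auto)
    moreover have "(D - {x}) \<inter> E `` {x} = {y}" using y irrefl by auto
    ultimately have "leg (insert x (D - {x})) x" by (intro extend) auto
    then show ?thesis using less.prems(2) by (simp add: insert_absorb)
  qed
qed

text \<open>Moving the root away from a component enlarges it; hence maximising components finds a
  vertex all of whose other components are simple.\<close>

lemma comp_shift:
  assumes "tree_on S" "v \<in> S" "x \<in> S \<inter> E `` {v}" "y \<in> S \<inter> E `` {v}" "x \<noteq> y" "u \<in> component (S - {v}) y"
  shows "\<exists>z\<in>S \<inter> E `` {u}. card (component (S - {v}) x) < card (component (S - {u}) z)"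
proof -
  have sub: "component (S - {v}) a \<subseteq> S - {v}" if "a \<in> S \<inter> E `` {v}" for a
    using that irrefl by (intro comp_subset) auto
  have u: "u \<in> S" "u \<noteq> v" using sub[OF assms(4)] assms(6) by auto
  then have "v \<in> S - {u}" using assms by auto
  then obtain z where z: "z \<in> S \<inter> E `` {u}" "v \<in> component (S - {u}) z"
    using tree_split[OF assms(1) u(1)] by blast
  have zS: "z \<in> S - {u}" using z irrefl by auto
  have "u \<notin> component (S - {v}) x"
    using tree_split_nonadj[OF assms(1-5)] assms(6) by (auto simp: nonadj_def)
  then have "component (S - {v}) x \<subseteq> component (S - {u}) x"
    using sub[OF assms(3)] assms(3) irrefl by (intro comp_subset_comp) auto
  moreover have "x \<noteq> u" using \<open>u \<notin> component (S - {v}) x\<close> self_in_comp by blast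
  then have "x \<in> component (S - {u}) z"
    using comp_step[OF z(2), of x] zS assms(3) by auto
  ultimately have "insert v (component (S - {v}) x) \<subseteq> component (S - {u}) z"
    using z(2) by (blast intro: comp_trans)
  moreover have "finite (component (S - {u}) z)"
    using comp_subset[OF zS] assms(1) unfolding tree_on_def by (meson finite_Diff finite_subset)
  moreover have "v \<notin> component (S - {v}) x" using sub[OF assms(3)] by blast
  ultimately have "component (S - {v}) x \<subset> component (S - {u}) z" by blast
  then show ?thesis using z \<open>finite (component (S - {u}) z)\<close> by (blast intro: psubset_card_mono)
qed

lemma extremal_vertex:
  assumes "tree_on S" "v\<^sub>0 \<in> S" "Q v\<^sub>0" "S \<inter> E `` {v\<^sub>0} \<noteq> {}"
  obtains v w where "v \<in> S" "Q v" "w \<in> S \<inter> E `` {v}"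
    "\<And>y u. y \<in> S \<inter> E `` {v} \<Longrightarrow> y \<noteq> w \<Longrightarrow> u \<in> component (S - {v}) y \<Longrightarrow> \<not> Q u"
proof -
  \<comment> \<open>A pair is a vertex satisfying \<open>Q\<close> with a neighbour; it is chosen so
    that the component of that neighbour is as large as possible.\<close>
  define P where "P p \<longleftrightarrow> fst p \<in> S \<and> Q (fst p) \<and> snd p \<in> S \<inter> E `` {fst p}" for p
  let ?f = "\<lambda>p. card (component (S - {fst p}) (snd p))"
  obtain w\<^sub>0 where "P (v\<^sub>0, w\<^sub>0)" using assms by (auto simp: P_def)
  moreover have "?f p < Suc (card S)" if "P p" for p
  proof -
    have "component (S - {fst p}) (snd p) \<subseteq> S - {fst p}"
      using that irrefl[of "fst p"] by (intro comp_subset, cases p) (auto simp: P_def)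
    then have "?f p \<le> card S" using assms(1) by (intro card_mono) (auto simp: tree_on_def)
    then show ?thesis by simp
  qed
  ultimately obtain p where p: "P p" "\<And>q. P q \<Longrightarrow> ?f q \<le> ?f p"
    using ex_has_greatest_nat[of P "(v\<^sub>0, w\<^sub>0)" ?f "Suc (card S)"] by blast
  show thesis
  proof (rule that[of "fst p" "snd p"])
    fix y u assume y: "y \<in> S \<inter> E `` {fst p}" "y \<noteq> snd p" and u: "u \<in> component (S - {fst p}) y"
    have "y \<in> S - {fst p}" using y irrefl by auto
    from comp_subset[OF this] have "u \<in> S" using u by blast
    \<comment> \<open>If \<open>u\<close> satisfied \<open>Q\<close>, the pair \<open>(u, z)\<close>
      would contradict maximality.\<close>
    obtain z where "z \<in> S \<inter> E `` {u}" "?f p < ?f (u, z)"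
      using comp_shift[OF assms(1), of "fst p" "snd p" y u] p(1) y u by (auto simp: P_def)
    then have "\<not> P (u, z)" using p(2) by fastforce
    then show "\<not> Q u" using \<open>z \<in> _\<close> \<open>u \<in> S\<close> by (auto simp: P_def)
  qed (use p(1) in \<open>auto simp: P_def\<close>)
qed

text \<open>Inside its component \<open>y\<close> has lost the neighbour \<open>v\<close>, so its
  degree there is at most 1 and \<open>tree_leg\<close> applies.\<close>

lemma comp_leg:
  assumes "tree_on S" "v \<in> S" "y \<in> S \<inter> E `` {v}"
    "\<And>u. u \<in> component (S - {v}) y \<Longrightarrow> card (S \<inter> E `` {u}) \<le> 2"
  shows "leg (component (S - {v}) y) y"
proof (rule tree_leg)
  have fin: "finite S" using assms by (simp add: tree_on_def)
  have y: "y \<in> S - {v}" using assms irrefl by auto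
  then show "tree_on (component (S - {v}) y)" using assms by (intro tree_comp) auto
  have sub: "component (S - {v}) y \<subseteq> S - {v}" using y by (rule comp_subset)
  show "card (component (S - {v}) y \<inter> E `` {u}) \<le> 2" if "u \<in> component (S - {v}) y" for u
  proof -
    have "card (component (S - {v}) y \<inter> E `` {u}) \<le> card (S \<inter> E `` {u})"
      using sub fin by (intro card_mono) auto
    then show ?thesis using assms(4)[OF that] by simp
  qed
  have "v \<in> S \<inter> E `` {y}" using assms sym by auto
  then have "card (S \<inter> E `` {y} - {v}) = card (S \<inter> E `` {y}) - 1" using fin by (simp add: card_Diff_singleton)
  moreover have "card (component (S - {v}) y \<inter> E `` {y}) \<le> card (S \<inter> E `` {y} - {v})"
    using sub fin by (intro card_mono) auto
  ultimately show "card (component (S - {v}) y \<inter> E `` {y}) \<le> 1" using assms(4)[of y] by simp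
qed simp

text \<open>With the trivial predicate, \<open>extremal_vertex\<close> yields a leaf: any neighbour
  other than \<open>w\<close> would be a forbidden vertex of its own component.\<close>

lemma tree_no_branch_leg:
  assumes "tree_on S" "\<And>u. u \<in> S \<Longrightarrow> card (S \<inter> E `` {u}) \<le> 2"
  shows "\<exists>x. leg S x"
proof -
  obtain v\<^sub>0 where v0: "v\<^sub>0 \<in> S" using assms by (auto simp: tree_on_def)
  show ?thesis
  proof (cases "S \<inter> E `` {v\<^sub>0} = {}")
    case True
    then show ?thesis using tree_leg[OF assms(1) v0] assms(2) by auto
  next
    case False
    show ?thesis
    proof (rule extremal_vertex[where Q = "\<lambda>_. True", OF assms(1) v0 TrueI False])
      fix v w
      assume "v \<in> S" "w \<in> S \<inter> E `` {v}"
        and "\<And>y u. y \<in> S \<inter> E `` {v} \<Longrightarrow> y \<noteq> w \<Longrightarrow> u \<in> component (S - {v}) y \<Longrightarrow> \<not> True"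
      then have "S \<inter> E `` {v} = {w}" using self_in_comp by blast
      then show ?thesis using tree_leg[OF assms(1) \<open>v \<in> S\<close>] assms(2) by auto
    qed
  qed
qed

section \<open>The excess of a tree\<close>

text \<open>A weak bound that also covers short paths, for the components left after deleting
  \<open>w\<close>; \<open>0.1138\<close> is the excess of the path with 2 vertices, rounded
  down.\<close>

lemma tree_on_exc_ge:
  assumes "tree_on D" "(\<exists>u\<in>D. 3 \<le> card (D \<inter> E `` {u})) \<Longrightarrow> offset \<le> exc D"
  shows "0.1138 \<le> exc D"
proof (cases "\<exists>u\<in>D. 3 \<le> card (D \<inter> E `` {u})")
  case True
  then show ?thesis using assms(2) offset_bounds by simp
next
  case False
  then have "card (D \<inter> E `` {u}) \<le> 2" if "u \<in> D" for u using that by force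
  then obtain x where "leg D x" using tree_no_branch_leg[OF assms(1)] by blast
  then show ?thesis using leg_exc leg_card path_exc_ge by simp
qed

text \<open>\<open>IH\<close> also applies to \<open>C\<close> itself, so an excess below
  \<open>offset\<close> forces \<open>C\<close> to be a path. The vertex \<open>w\<close> may be an
  interior vertex of it.\<close>

lemma rest_ok_tree_on:
  assumes "tree_on C" "w \<in> C"
    and IH: "\<And>D. tree_on D \<Longrightarrow> D \<subseteq> C \<Longrightarrow> \<exists>u\<in>D. 3 \<le> card (D \<inter> E `` {u}) \<Longrightarrow> offset \<le> exc D"
  shows "rest_ok (exc C - slope - offset) (exc (C - {w}) + 1 - 2 * slope - offset) (ratio C w)"
proof -
  have fin: "finite C" using assms by (simp add: tree_on_def)
  define K where "K = C \<inter> E `` {w}"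
  let ?D = "component (C - {w})"
  have K: "y \<in> C - {w}" if "y \<in> K" for y using that irrefl by (auto simp: K_def)
  have excm: "exc (C - {w}) = (\<Sum>y\<in>K. exc (?D y))"
    unfolding K_def by (rule tree_exc_minus[OF assms(1,2)])
  have D_ge: "0.1138 \<le> exc (?D y)" if "y \<in> K" for y
  proof (rule tree_on_exc_ge)
    show "tree_on (?D y)" using assms(1) K[OF that] by (intro tree_comp) auto
    moreover have "?D y \<subseteq> C" using comp_subset[OF K[OF that]] by blast
    ultimately show "offset \<le> exc (?D y)" if "\<exists>u\<in>?D y. 3 \<le> card (?D y \<inter> E `` {u})"
      using IH that by blast
  qed
  have r: "1 / 2 \<le> ratio C w" "ratio C w \<le> 1"
    unfolding ratio_def using ratio_bounds[OF fin assms(2)] by auto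
  have finK: "finite K" using fin by (simp add: K_def)
  have sum_ge: "0.1138 * card K \<le> exc (C - {w})"
    unfolding excm using sum_bounded_below[of K "0.1138" "\<lambda>y. exc (?D y)"] D_ge by simp
  show ?thesis
  proof (cases "C = {w}")
    case True
    then have "leg C w" by (simp add: single)
    from leg_exc[OF this] leg_ratio[OF this] show ?thesis
      using True slope_bounds offset_bounds by (simp add: rest_ok_def path_ratio_def)
  next
    case False
    then have "K \<noteq> {}"
      using tree_split[OF assms(1,2)] assms(2) unfolding K_def by auto
    then have cK: "1 \<le> card K" using finK by (simp add: card_gt_0_iff Suc_leI)
    then have "0.1138 * 1 \<le> 0.1138 * real (card K)" by simp
    then have e1: "0.1138 \<le> exc (C - {w})" using sum_ge by linarith
    show ?thesis
    \<comment> \<open>The first case includes the path with 3 vertices, whose excess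
      \<open>1 - 3 * slope\<close> exceeds \<open>offset\<close>.\<close>
    proof (cases "offset \<le> exc C")
      case True
      then show ?thesis
        using e1 r slope_bounds offset_bounds by (simp add: rest_ok_def)
    next
      case False
      then have deg: "card (C \<inter> E `` {u}) \<le> 2" if "u \<in> C" for u
        using IH[OF assms(1) subset_refl] that by force
      obtain x where x: "leg C x" using tree_no_branch_leg[OF assms(1) deg] by blast
      have exC: "exc C = path_exc (card C)" using leg_exc[OF x] .
      have cw: "card C = Suc (card (C - {w}))" using fin assms(2) by (metis card_Suc_Diff1)
      have c1: "card C \<noteq> 1" using \<open>C \<noteq> {w}\<close> assms(2) by (metis card_1_singletonE singletonD)
      have "card C \<noteq> 3"
        using False exC slope_bounds offset_bounds by auto
      then consider "card C = 2" | "card C \<ge> 4" using c1 cw by linarith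
      then show ?thesis
      proof cases
        case 1
        then obtain z where "C - {w} = {z}" using cw by (auto simp: card_1_singleton_iff)
        then have "leg (C - {w}) z" by (simp add: single)
        from leg_counts[OF this] leg_counts[OF x] have "ratio C w = 2 / 3"
          using 1 cw by (auto simp: ratio_def)
        moreover have "exc (C - {w}) = 1 / 2 - slope"
          using leg_exc[OF \<open>leg (C - {w}) z\<close>] 1 cw by simp
        ultimately show ?thesis
          using exC 1 slope_bounds offset_bounds by (simp add: rest_ok_def)
      next
        case 2
        have legs: "leg (?D y) y" if "y \<in> K" for y
          using comp_leg[OF assms(1,2), of y] that deg comp_subset[OF K[OF that]] unfolding K_def by blast
        \<comment> \<open>Deleting \<open>w\<close> leaves either one path with at least 3 vertices
          or several paths with excess at least \<open>0.1138\<close> each.\<close>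
        have "0.1444 \<le> exc (C - {w})"
        proof (cases "card K = 1")
          case True
          then obtain y where y: "K = {y}" by (auto simp: card_1_singleton_iff)
          then have "C - {w} = ?D y" using tree_split[OF assms(1,2)] unfolding K_def by simp
          then have "leg (C - {w}) y" using legs y by simp
          from leg_exc[OF this] show ?thesis using path_exc_ge3[of "card (C - {w})"] cw 2 by simp
        next
          case False
          then have "0.1138 * 2 \<le> 0.1138 * real (card K)" using cK by simp
          then show ?thesis using sum_ge by simp
        qed
        moreover have "3 / 5 \<le> ratio C w"
        proof -
          \<comment> \<open>One factor is at most \<open>2 / 3\<close> and the others at most
            \<open>1\<close>, so \<open>1 / (1 + t)\<close> is at least
            \<open>3 / 5\<close>.\<close>
          define t where "t = (\<Prod>y\<in>K. ratio (?D y) y)"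
          have rl: "0 \<le> ratio (?D y) y \<and> ratio (?D y) y \<le> 2 / 3" if "y \<in> K" for y
            using path_ratio_le[OF leg_card[OF legs[OF that]]] leg_ratio[OF legs[OF that]]
            by (simp add: path_ratio_def)
          obtain y where y: "y \<in> K" using \<open>K \<noteq> {}\<close> by blast
          have "(\<Prod>z\<in>K - {y}. ratio (?D z) z) \<le> 1"
          proof (rule prod_le_1)
            fix z assume "z \<in> K - {y}"
            then show "0 \<le> ratio (?D z) z \<and> ratio (?D z) z \<le> 1" using rl[of z] by auto
          qed
          moreover have "0 \<le> (\<Prod>z\<in>K - {y}. ratio (?D z) z)" using rl by (intro prod_nonneg) auto
          ultimately have "ratio (?D y) y * (\<Prod>z\<in>K - {y}. ratio (?D z) z) \<le> 2 / 3 * 1"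
            using rl[OF y] by (intro mult_mono) auto
          then have "t \<le> 2 / 3" unfolding t_def prod.remove[OF finK y] by simp
          moreover have "0 \<le> t" unfolding t_def using rl by (intro prod_nonneg) auto
          moreover have "ratio C w = 1 / (1 + t)"
            using tree_ratio_rec[OF assms(1,2)] by (simp add: t_def K_def)
          ultimately show ?thesis using frac_le[of 1 1 "1 + t" "5 / 3"] by simp
        qed
        moreover have "0.1444 \<le> exc C" using exC path_exc_ge3 2 by simp
        ultimately show ?thesis
          using r slope_bounds offset_bounds by (simp add: rest_ok_def)
      qed
    qed
  qed
qed

lemma branching_tree_exc_ge:
  assumes "tree_on S" "\<exists>u\<in>S. 3 \<le> card (S \<inter> E `` {u})"
  shows "offset \<le> exc S"
  using assms
proof (induction "card S" arbitrary: S rule: less_induct)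
  case less
  have fin: "finite S" using less.prems by (simp add: tree_on_def)
  obtain u where u: "u \<in> S" "3 \<le> card (S \<inter> E `` {u})" using less.prems by blast
  have "S \<inter> E `` {u} \<noteq> {}" using u by auto
  show ?case
  \<comment> \<open>Only the component of \<open>w\<close> can contain further branching vertices,
    so the others, of which there are at least two, are legs.\<close>
  proof (rule extremal_vertex[where Q = "\<lambda>u. 3 \<le> card (S \<inter> E `` {u})", OF less.prems(1) u \<open>S \<inter> E `` {u} \<noteq> {}\<close>])
    fix v w
    assume v: "v \<in> S" "3 \<le> card (S \<inter> E `` {v})" and w: "w \<in> S \<inter> E `` {v}"
      and small: "\<And>y u. y \<in> S \<inter> E `` {v} \<Longrightarrow> y \<noteq> w \<Longrightarrow> u \<in> component (S - {v}) y
        \<Longrightarrow> \<not> 3 \<le> card (S \<inter> E `` {u})"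
    define K where "K = S \<inter> E `` {v}"
    let ?C = "component (S - {v})"
    have finK: "finite K" "w \<in> K" using fin w by (auto simp: K_def)
    have K: "y \<in> S - {v}" if "y \<in> K" for y using that irrefl by (auto simp: K_def)
    have rest: "rest_ok (exc (?C w) - slope - offset) (exc (?C w - {w}) + 1 - 2 * slope - offset) (ratio (?C w) w)"
    proof (rule rest_ok_tree_on)
      show "tree_on (?C w)" using less.prems(1) K finK by (intro tree_comp) auto
      fix D assume D: "tree_on D" "D \<subseteq> ?C w" "\<exists>u\<in>D. 3 \<le> card (D \<inter> E `` {u})"
      have "D \<subseteq> S - {v}" using comp_subset[OF K[OF finK(2)]] D by blast
      then have "card D < card S" using fin v by (intro psubset_card_mono) auto
      then show "offset \<le> exc D" using less.hyps D by blast
    qed simp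
    have legs: "leg_ok (exc (?C y)) (exc (?C y - {y}) - slope) (ratio (?C y) y)" if "y \<in> K - {w}" for y
    proof -
      have "card (S \<inter> E `` {u}) \<le> 2" if "u \<in> ?C y" for u
        using small[of y u] \<open>y \<in> K - {w}\<close> that by (simp add: K_def)
      then have "leg (?C y) y"
        using comp_leg[OF less.prems(1) v(1)] that by (simp add: K_def)
      then show ?thesis using leg_ok_path leg_exc leg_exc' leg_ratio leg_card by simp
    qed
    define t where "t = (\<Prod>y\<in>K. ratio (?C y) y)"
    have "card (K - {w}) \<ge> 2" using v finK by (simp add: K_def)
    \<comment> \<open>The component of \<open>w\<close> is separated from the legs and absorbs all
      constant terms of the conditioning formula.\<close>
    from legs_nonneg[OF _ this rest legs] finK
    have "0 \<le> exc (?C w) - slope - offset + (\<Sum>y\<in>K - {w}. exc (?C y))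
      + ratio (?C w) w * (\<Prod>y\<in>K - {w}. ratio (?C y) y)
        * (exc (?C w - {w}) + 1 - 2 * slope - offset + (\<Sum>y\<in>K - {w}. exc (?C y - {y}) - slope))"
      by simp
    also have "\<dots> = (\<Sum>y\<in>K. exc (?C y)) - slope - offset
      + t * ((\<Sum>y\<in>K. exc (?C y - {y}) - slope) + 1 - slope - offset)"
      unfolding t_def sum.remove[OF finK] prod.remove[OF finK] by (simp add: algebra_simps)
    also have "\<dots> = (1 + t) * (exc S - offset)"
      using tree_exc_rec[OF less.prems(1) v(1), of offset] by (simp add: K_def t_def)
    finally have "0 \<le> (1 + t) * (exc S - offset)" .
    moreover have "0 \<le> t" unfolding t_def by (intro prod_nonneg) (simp add: ratio_def)
    ultimately show "offset \<le> exc S" by (simp add: zero_le_mult_iff)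
  qed
qed

text \<open>Vertices are numbered from the far end, so the root has the largest index and a newly
  attached vertex gets the number \<open>card D\<close>. This provides the isomorphism with
  \<open>path_graph\<close>.\<close>

lemma leg_index:
  "leg D x \<Longrightarrow> \<exists>f. bij_betw f D {..<card D} \<and> f x = card D - 1
     \<and> (\<forall>u\<in>D. \<forall>v\<in>D. (u, v) \<in> E \<longleftrightarrow> f v = Suc (f u) \<or> f u = Suc (f v))"
proof (induction rule: leg.induct)
  case (single x)
  then show ?case using irrefl by (intro exI[of _ "\<lambda>_. 0"]) (auto simp: bij_betw_def)
next
  case (extend D y x)
  then obtain f where f: "bij_betw f D {..<card D}" "f y = card D - 1"
    "\<And>u v. u \<in> D \<Longrightarrow> v \<in> D \<Longrightarrow> (u, v) \<in> E \<longleftrightarrow> f v = Suc (f u) \<or> f u = Suc (f v)" by blast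
  have fin: "finite D" "y \<in> D" using leg_finite extend by auto
  then have c: "card D \<ge> 1" using leg_card[OF extend.hyps(1)] by simp
  have lt: "f u < card D" if "u \<in> D" for u using f(1) that by (auto simp: bij_betw_def)
  have inj: "f u = f y \<longleftrightarrow> u = y" if "u \<in> D" for u
    using f(1) that fin by (auto simp: bij_betw_def inj_on_def)
  let ?g = "f(x := card D)"
  have "bij_betw ?g D {..<card D}"
    using f(1) extend.hyps(2) by (subst bij_betw_cong[of D ?g f]) auto
  then have "bij_betw ?g (insert x D) (insert (card D) {..<card D})"
    using notIn_Un_bij_betw[of x D ?g "{..<card D}"] extend.hyps(2) by simp
  then have bij: "bij_betw ?g (insert x D) {..<card (insert x D)}"
    using fin extend.hyps(2) by (simp add: lessThan_Suc)
  have xu: "(x, u) \<in> E \<longleftrightarrow> card D = Suc (f u)" if "u \<in> D" for u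
  proof -
    have "(x, u) \<in> E \<longleftrightarrow> u = y" using extend.hyps(3) that by blast
    also have "\<dots> \<longleftrightarrow> f u = card D - 1" using inj[OF that] f(2) by simp
    also have "\<dots> \<longleftrightarrow> card D = Suc (f u)" using c by linarith
    finally show ?thesis .
  qed
  have adj: "(u, v) \<in> E \<longleftrightarrow> ?g v = Suc (?g u) \<or> ?g u = Suc (?g v)"
    if uv: "u \<in> insert x D" "v \<in> insert x D" for u v
  proof -
    consider "u = x" "v = x" | "u = x" "v \<in> D" "v \<noteq> x" | "v = x" "u \<in> D" "u \<noteq> x"
      | "u \<in> D" "v \<in> D" "u \<noteq> x" "v \<noteq> x"
      using uv extend.hyps(2) by blast
    then show ?thesis
    proof cases
      case 1
      then show ?thesis using irrefl by simp
    next
      case 2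
      then show ?thesis using xu lt[of v] by auto
    next
      case 3
      then show ?thesis using xu[of u] lt[of u] sym by auto
    next
      case 4
      then show ?thesis using f(3) by simp
    qed
  qed
  have "?g x = card (insert x D) - 1" using fin extend.hyps(2) by simp
  then show ?case using bij adj by (intro exI[of _ ?g] conjI ballI)
qed

end

section \<open>Transfer to pair graphs\<close>

lemma avi_eq_exc:
  assumes "simple_graph (parcs G)"
  shows "avi G = simple_graph.exc (parcs G) (pverts G) + slope * real (card (pverts G))"
proof -
  interpret simple_graph "parcs G" by fact
  have "{S. independent_set G S} = ind (pverts G)"
    by (auto simp: independent_set_def ind_def)
  then show ?thesis
    by (simp add: avi_def num_indep_def total_indep_def exc_def cnt_def tot_def)
qed

lemma simple_graph_path_graph: "simple_graph (parcs (path_graph n))"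
  by unfold_locales (auto simp: path_graph_def)

lemma avi_path_graph:
  assumes "0 < n"
  shows "avi (path_graph n) = path_exc n + slope * real n"
proof -
  interpret simple_graph "parcs (path_graph n)" by (rule simple_graph_path_graph)
  \<comment> \<open>Initial segments of the path grow at their last vertex, which serves as the
    root.\<close>
  have "leg {..<Suc k} k" if "Suc k \<le> n" for k
    using that
  proof (induction k)
    case 0
    have "{..<Suc 0} = {0::nat}" by auto
    then show ?case by (simp add: single)
  next
    case (Suc k)
    have "leg (insert (Suc k) {..<Suc k}) (Suc k)"
    proof (rule extend)
      show "leg {..<Suc k} k" using Suc by simp
      show "{..<Suc k} \<inter> parcs (path_graph n) `` {Suc k} = {k}"
        using Suc.prems by (auto simp: path_graph_def)
    qed simp
    then show ?case by (simp add: lessThan_Suc)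
  qed
  from this[of "n - 1"] have "leg {..<n} (n - 1)" using assms by simp
  from leg_exc[OF this] show ?thesis
    using avi_eq_exc[OF simple_graph_path_graph[of n]] by (simp add: path_graph_def)
qed

lemma pawalk_verts_snoc: "pcas u p (fst e) \<Longrightarrow> pawalk_verts u (p @ [e]) = pawalk_verts u p @ [snd e]"
  by (induction p arbitrary: u) auto

lemma pcas_snoc: "pcas u (p @ [e]) v \<longleftrightarrow> pcas u p (fst e) \<and> snd e = v"
  by (induction p arbitrary: u) auto

lemma simple_graph_undirected_tree:
  assumes "undirected_tree T"
  shows "simple_graph (parcs T)"
proof
  interpret pair_graph T using assms by (simp add: undirected_tree_def)
  show "(v, u) \<in> parcs T" if "(u, v) \<in> parcs T" for u v
    using pair_sym_arcs that by (auto simp: symmetric_def dest: symD)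
  show "(v, v) \<notin> parcs T" for v using pair_no_loops by fastforce
qed

text \<open>Two neighbours of \<open>v\<close> joined by a path avoiding \<open>v\<close> would
  close up to an undirected cycle through \<open>v\<close>.\<close>

lemma tree_on_undirected_tree:
  assumes "undirected_tree T"
  shows "simple_graph.tree_on (parcs T) (pverts T)"
proof -
  interpret G: pair_graph T using assms by (simp add: undirected_tree_def)
  interpret simple_graph "parcs T" using assms by (rule simple_graph_undirected_tree)
  let ?S = "pverts T"
  have E: "parcs T \<inter> ?S \<times> ?S = parcs T" using G.wellformed' by auto
  \<comment> \<open>Connectedness is defined through the symmetric closure, which adds no arcs
    here.\<close>
  have "parcs (mk_symmetric (with_proj T)) = parcs T"
    using sym by (auto simp: parcs_mk_symmetric)
  moreover have "Digraph_Component.connected (with_proj T)" using assms by (simp add: undirected_tree_def)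
  ultimately have conn: "?S \<noteq> {}" "\<And>u v. u \<in> ?S \<Longrightarrow> v \<in> ?S \<Longrightarrow> (u, v) \<in> (parcs T)\<^sup>*"
    unfolding connected_def strongly_connected_def
    using reachable_rtranclI[where G = "with_proj (mk_symmetric (with_proj T))"] by auto
  have "x = y" if v: "v \<in> ?S" "(v, x) \<in> parcs T" "(v, y) \<in> parcs T" "y \<in> component (?S - {v}) x" for v x y
  proof (rule ccontr)
    assume "x \<noteq> y"
    define H where "H = \<lparr>pverts = ?S - {v}, parcs = parcs T \<inter> (?S - {v}) \<times> (?S - {v})\<rparr>"
    interpret H: pair_wf_digraph H by unfold_locales (auto simp: H_def)
    have "x \<in> ?S - {v}" using v irrefl G.wellformed' by auto
    then have "x \<rightarrow>\<^sup>*\<^bsub>with_proj H\<^esub> y"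
      using v(4) H.reachable_conv' by (simp add: component_def H_def)
    then obtain p where "H.apath x p y" using H.reachable_apath by blast
    then have p: "set p \<subseteq> parcs H" "pcas x p y" "distinct (pawalk_verts x p)" "set (pawalk_verts x p) \<subseteq> pverts H"
      using H.awalk_verts_in_verts by (auto simp: H.apath_def H.awalk_def)
    have "p \<noteq> []" using p(2) \<open>x \<noteq> y\<close> by auto
    \<comment> \<open>As \<open>x\<close> and \<open>y\<close> differ, \<open>p\<close> is nonempty,
      so the closed walk has length at least 3.\<close>
    let ?c = "(v, x) # p @ [(y, v)]"
    have "set ?c \<subseteq> parcs T" using p(1) v sym by (auto simp: H_def)
    moreover have "pcas v ?c v" using p(2) by (simp only: pcas.simps pcas_snoc fst_conv snd_conv simp_thms)
    ultimately have "G.awalk v ?c v" using v(1) unfolding G.awalk_def by blast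
    moreover have "distinct (tl (pawalk_verts v ?c))"
      using p pawalk_verts_snoc[of x p "(y, v)"] by (auto simp: H_def)
    ultimately have "undirected_cycle T ?c"
      using \<open>p \<noteq> []\<close> unfolding undirected_cycle_def G.cycle_def by (auto simp: Suc_le_eq)
    then show False using assms by (auto simp: undirected_tree_def)
  qed
  then show ?thesis
    using conn G.pair_finite_verts unfolding tree_on_def component_def E by blast
qed

lemma is_path_leg:
  assumes "simple_graph (parcs T)" "pair_wf_digraph T" "simple_graph.leg (parcs T) (pverts T) x"
  shows "is_path T"
proof -
  interpret simple_graph "parcs T" by fact
  interpret G: pair_wf_digraph T by fact
  let ?n = "card (pverts T)"
  obtain f where f: "bij_betw f (pverts T) {..<?n}"
    "\<And>u v. u \<in> pverts T \<Longrightarrow> v \<in> pverts T \<Longrightarrow> (u, v) \<in> parcs T \<longleftrightarrow> f v = Suc (f u) \<or> f u = Suc (f v)"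
    using leg_index[OF assms(3)] by blast
  define h where "h = \<lparr>iso_verts = f, iso_arcs = map_prod f f, iso_head = snd, iso_tail = fst\<rparr>"
  have inj: "inj_on f (pverts T)" and im: "f ` pverts T = {..<?n}" using f(1) by (auto simp: bij_betw_def)
  have sub: "parcs T \<subseteq> pverts T \<times> pverts T" using G.wellformed' by auto
  have "inj_on (map_prod f f) (parcs T)"
    using map_prod_inj_on[OF inj inj] sub by (rule inj_on_subset)
  then have "G.digraph_isomorphism h"
    unfolding G.digraph_isomorphism_def using inj G.wf_digraph_axioms by (auto simp: h_def)
  moreover have "map_prod f f ` parcs T = parcs (path_graph ?n)"
  proof (intro equalityI subsetI)
    fix e assume "e \<in> map_prod f f ` parcs T"
    then show "e \<in> parcs (path_graph ?n)" using f(2) im sub by (force simp: path_graph_def)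
  next
    fix e assume e: "e \<in> parcs (path_graph ?n)"
    then have "fst e \<in> f ` pverts T" "snd e \<in> f ` pverts T" unfolding im by (auto simp: path_graph_def)
    then obtain u v where "u \<in> pverts T" "v \<in> pverts T" "e = (f u, f v)" by (metis imageE prod.collapse)
    then show "e \<in> map_prod f f ` parcs T" using f(2) e by (force simp: path_graph_def)
  qed
  then have "with_proj (path_graph ?n) = app_iso h (with_proj T)"
    using im by (simp add: app_iso_def h_def with_proj_def path_graph_def)
  ultimately show ?thesis unfolding is_path_def digraph_iso_def by blast
qed

text \<open>A branching vertex and three neighbours give order at least 4. This matters for
  comparing with paths: those with 1 or 3 vertices have excess above \<open>offset\<close>, and
  \<open>path_exc n <= offset\<close> is available from \<open>n = 4\<close> on.\<close>

lemma undirected_tree_cases: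
  assumes "undirected_tree T"
  obtains (path) "is_path T" "avi T = avi (path_graph (card (pverts T)))"
    | (branch) "4 \<le> card (pverts T)" "slope * real (card (pverts T)) + offset \<le> avi T"
proof -
  interpret G: pair_graph T using assms by (simp add: undirected_tree_def)
  have sg: "simple_graph (parcs T)" using assms by (rule simple_graph_undirected_tree)
  interpret simple_graph "parcs T" by (rule sg)
  have tree: "tree_on (pverts T)" using assms by (rule tree_on_undirected_tree)
  show thesis
  proof (cases "\<exists>u\<in>pverts T. 3 \<le> card (pverts T \<inter> parcs T `` {u})")
    case True
    then obtain u where u: "u \<in> pverts T" "3 \<le> card (pverts T \<inter> parcs T `` {u})" by blast
    have "card (pverts T \<inter> parcs T `` {u}) < card (pverts T)"
      using u irrefl G.pair_finite_verts by (intro psubset_card_mono) auto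
    then show thesis
      using branch u branching_tree_exc_ge[OF tree True] avi_eq_exc[OF sg] by simp
  next
    case False
    then have "card (pverts T \<inter> parcs T `` {u}) \<le> 2" if "u \<in> pverts T" for u using that by force
    then obtain x where x: "leg (pverts T) x" using tree_no_branch_leg[OF tree] by blast
    have "0 < card (pverts T)" using leg_card[OF x] by simp
    then show thesis
      using path is_path_leg[OF sg G.pair_wf_digraph_axioms x] leg_exc[OF x] avi_eq_exc[OF sg] avi_path_graph by simp
  qed
qed

theorem theorem4p4:
  fixes a b :: real
  assumes "a = (5 - sqrt 5) / 10"
    and "b = (79 * sqrt 5 - 165) / 70"
  shows "(\<forall>(n::nat) (T :: 'a pair_pre_digraph).
            undirected_tree T \<and> card (pverts T) = n \<and> \<not> is_path T \<longrightarrow> avi T \<ge> a * real n + b)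
       \<and> (\<forall>(n::nat) (T :: 'a pair_pre_digraph).
            n > 0 \<and> undirected_tree T \<and> card (pverts T) = n \<longrightarrow> avi (path_graph n) \<le> avi T)"
proof (intro conjI allI impI; elim conjE)
  fix n and T :: "'a pair_pre_digraph"
  assume T: "undirected_tree T" "card (pverts T) = n" "\<not> is_path T"
  have "a = slope" "b = offset" using assms by (simp_all add: slope_def offset_def)
  then show "avi T \<ge> a * real n + b"
    using T by (cases rule: undirected_tree_cases[OF T(1)]) simp_all
next
  fix n and T :: "'a pair_pre_digraph"
  assume T: "n > 0" "undirected_tree T" "card (pverts T) = n"
  from T(2) show "avi (path_graph n) \<le> avi T"
  proof (cases rule: undirected_tree_cases)
    case branch
    then show ?thesis using path_exc_ge4(2)[of n] avi_path_graph[of n] T by simp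
  qed (use T in simp)
qed

end
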